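(* Let $G$ be a locally compact Abelian group with arcwise connected dual group $\hat G=\mathbb{R}^d\times\mathbb{T}^n$. Let $\mu$ be a probability measure on $G$ such that $\mathcal{N}(\hat\mu)\neq\emptyset$, and assume that $\hat\mu$ is $C^3$-differentiable at $1\in\hat G$. Then $\Lambda^{\mathrm{alg}}(\mu)$ is bounded from below by $t_0(\mu)$, i.e. $$\Lambda^{\mathrm{alg}}(\mu)\subseteq\mathbb{Q}\cap[t_0(\mu),\infty).$$
   Context: For a locally compact Abelian group $(G,+)$, $(\hat G,\cdot)$ denotes its dual group (continuous characters) with identity element $1$, and $\hat\mu:\hat G\to\mathbb{C}$ denotes the Fourier transform of a probability measure $\mu$ on (the Borel $\sigma$-algebra of) $G$. Here $\mathbb{T}^n$ is the $n$-dimensional torus, and $\hat G=\mathbb{R}^d\times\mathbb{T}^n$ carries its usual smooth structure. A characteristic function on $\hat G$ is the Fourier transform of a probability measure on $G$. $\mathbb{N}=\{1,2,3,\dots\}$. For a probability measure $\mu$ on $G$, $$\Lambda^{\mathrm{alg}}(\mu)=\Big\{q=\tfrac{m}{k}: k,m\in\mathbb{N}\text{ mutually prime, and there exists a characteristic function }\widehat{\mu_{m/k}}\text{ with }(\hat\mu)^m=(\widehat{\mu_{m/k}})^k\Big\}.$$ The zero set of $\hat\mu$ is $\mathcal{N}(\hat\mu)=\{\gamma\in\hat G:\hat\mu(\gamma)=0\}$. For $\gamma_0\in\hat G$, $\mathcal{P}(\gamma_0)$ denotes the collection of all smooth paths $\alpha:(-1,1)\to\hat G$ with $\alpha(0)=\gamma_0$.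 If $\mathcal{N}(\hat\mu)\neq\emptyset$ and $\hat\mu$ is $C^3$-differentiable at $1$, define $$t_0(\mu)=\sup_{\gamma_0\in\mathcal{N}(\hat\mu)}\ \sup_{\alpha\in\mathcal{P}(\gamma_0)}\ \sup\Big\{t\ge0:\ \limsup_{s\to+0}s^{-1}|\hat\mu(\alpha(s))|^t=\infty\Big\},$$ where $|\hat\mu(\alpha(s))|^0$ is understood as $1$, so that the innermost set always contains $t=0$ (it is also bounded above by $1$, so $t_0(\mu)$ is well defined). *)

theory Defs
  imports
    "HOL-Probability.Probability"
    "HOL-Algebra.Product_Groups"
begin

text \<open>The dual group of an additively written topological group: continuous characters with
  pointwise multiplication and the compact-open topology (on characters this is uniform
  convergence on compact sets).\<close>

definition characters :: "('g::topological_ab_group_add \<Rightarrow> complex) set" where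
  "characters = {\<gamma>. continuous_on UNIV \<gamma> \<and> (\<forall>x. cmod (\<gamma> x) = 1) \<and> (\<forall>x y. \<gamma> (x + y) = \<gamma> x * \<gamma> y)}"

definition dual_group :: "('g::topological_ab_group_add \<Rightarrow> complex) monoid" where
  "dual_group = \<lparr>carrier = characters, monoid.mult = (\<lambda>\<gamma> \<eta> x. \<gamma> x * \<eta> x), one = (\<lambda>_. 1)\<rparr>"

definition dual_topology :: "('g::topological_ab_group_add \<Rightarrow> complex) topology" where
  "dual_topology =
     topology_generated_by {{\<gamma> \<in> characters. \<gamma> ` K \<subseteq> U} | K U. compact K \<and> open U}"

definition real_group :: "real monoid" where
  "real_group = \<lparr>carrier = UNIV, monoid.mult = (+), one = 0\<rparr>"

definition circle_group :: "complex monoid" where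
  "circle_group = \<lparr>carrier = sphere 0 1, monoid.mult = (*), one = 1\<rparr>"

text \<open>The model \<open>\<real>\<^sup>d \<times> \<T>\<^sup>n\<close>. Coordinates are indexed by \<open>{..<d}\<close> and \<open>{..<n}\<close>, so \<open>d = 0\<close> and
  \<open>n = 0\<close> are allowed; tuples are extensional functions on \<open>nat\<close>.\<close>

definition RT_group :: "nat \<Rightarrow> nat \<Rightarrow> ((nat \<Rightarrow> real) \<times> (nat \<Rightarrow> complex)) monoid" where
  "RT_group d n = product_group {..<d} (\<lambda>_. real_group) \<times>\<times> product_group {..<n} (\<lambda>_. circle_group)"

definition RT_topology :: "nat \<Rightarrow> nat \<Rightarrow> ((nat \<Rightarrow> real) \<times> (nat \<Rightarrow> complex)) topology" where
  "RT_topology d n =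
     prod_topology (product_topology (\<lambda>_. euclideanreal) {..<d})
                   (product_topology (\<lambda>_. top_of_set (sphere 0 1)) {..<n})"

text \<open>\<open>fourier \<mu>\<close> is only meaningful on \<open>characters\<close>.\<close>

definition fourier :: "'g measure \<Rightarrow> ('g::topological_ab_group_add \<Rightarrow> complex) \<Rightarrow> complex" where
  "fourier \<mu> \<gamma> = (LINT x|\<mu>. \<gamma> x)"

definition characteristic_function ::
    "(('g::topological_ab_group_add \<Rightarrow> complex) \<Rightarrow> complex) \<Rightarrow> bool" where
  "characteristic_function f \<longleftrightarrow>
     (\<exists>\<nu>. prob_space \<nu> \<and> sets \<nu> = sets borel \<and> (\<forall>\<gamma>\<in>characters. f \<gamma> = fourier \<nu> \<gamma>))"

definition Lambda_alg :: "'g::topological_ab_group_add measure \<Rightarrow> real set" where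
  "Lambda_alg \<mu> = {real m / real k | m k. m \<ge> 1 \<and> k \<ge> 1 \<and> coprime m k \<and>
     (\<exists>f. characteristic_function f \<and> (\<forall>\<gamma>\<in>characters. fourier \<mu> \<gamma> ^ m = f \<gamma> ^ k))}"

definition zero_set :: "'g::topological_ab_group_add measure \<Rightarrow> ('g \<Rightarrow> complex) set" where
  "zero_set \<mu> = {\<gamma> \<in> characters. fourier \<mu> \<gamma> = 0}"

text \<open>\<open>Ck_on N k U f\<close>: for an open set \<open>U\<close> of \<open>\<real>\<^sup>N\<close> (extensional functions on \<open>{..<N}\<close>), all
  partial derivatives of \<open>f\<close> of order at most \<open>k\<close> exist and are continuous on \<open>U\<close>. The function
  \<open>g\<close> is the \<open>i\<close>-th partial derivative, uniquely determined on \<open>U\<close>.\<close>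

primrec Ck_on :: "nat \<Rightarrow> nat \<Rightarrow> (nat \<Rightarrow> real) set \<Rightarrow> ((nat \<Rightarrow> real) \<Rightarrow> complex) \<Rightarrow> bool" where
  "Ck_on N 0 U f \<longleftrightarrow>
     continuous_map (subtopology (product_topology (\<lambda>_. euclideanreal) {..<N}) U) euclidean f"
| "Ck_on N (Suc k) U f \<longleftrightarrow>
     continuous_map (subtopology (product_topology (\<lambda>_. euclideanreal) {..<N}) U) euclidean f \<and>
     (\<forall>i<N. \<exists>g. (\<forall>y\<in>U. ((\<lambda>t. f (y(i := t))) has_vector_derivative g y) (at (y i))) \<and> Ck_on N k U g)"

text \<open>The smooth covering \<open>\<real>\<^sup>d\<^sup>+\<^sup>n \<rightarrow> \<real>\<^sup>d \<times> \<T>\<^sup>n\<close>; near \<open>0\<close> it is the inverse of a chart of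
  \<open>\<real>\<^sup>d \<times> \<T>\<^sup>n\<close> at the identity.\<close>

definition RT_chart :: "nat \<Rightarrow> nat \<Rightarrow> (nat \<Rightarrow> real) \<Rightarrow> (nat \<Rightarrow> real) \<times> (nat \<Rightarrow> complex)" where
  "RT_chart d n y = (\<lambda>i\<in>{..<d}. y i, \<lambda>j\<in>{..<n}. cis (y (d + j)))"

text \<open>In the following, \<open>\<Phi>\<close> is an isomorphism of topological groups from \<open>\<real>\<^sup>d \<times> \<T>\<^sup>n\<close> onto the
  dual group, along which the smooth structure is transported. The choice of \<open>\<Phi>\<close> is immaterial,
  since continuous automorphisms of \<open>\<real>\<^sup>d \<times> \<T>\<^sup>n\<close> are smooth. ``\<open>C\<^sup>3\<close> at \<open>1\<close>'' means \<open>C\<^sup>3\<close> on some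
  neighbourhood of \<open>1\<close>.\<close>

definition C3_at_one ::
    "nat \<Rightarrow> nat \<Rightarrow> ((nat \<Rightarrow> real) \<times> (nat \<Rightarrow> complex) \<Rightarrow> 'g \<Rightarrow> complex) \<Rightarrow>
     (('g::topological_ab_group_add \<Rightarrow> complex) \<Rightarrow> complex) \<Rightarrow> bool" where
  "C3_at_one d n \<Phi> f \<longleftrightarrow>
     (\<exists>U. openin (product_topology (\<lambda>_. euclideanreal) {..<d + n}) U \<and> (\<lambda>i\<in>{..<d + n}. 0) \<in> U \<and>
          Ck_on (d + n) 3 U (\<lambda>y. f (\<Phi> (RT_chart d n y))))"

text \<open>\<open>D k\<close> is the \<open>k\<close>-th derivative of \<open>c\<close> on \<open>(-1, 1)\<close>.\<close>

definition smooth_curve :: "(real \<Rightarrow> 'b::real_normed_vector) \<Rightarrow> bool" where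
  "smooth_curve c \<longleftrightarrow>
     (\<exists>D::nat \<Rightarrow> real \<Rightarrow> 'b. D 0 = c \<and>
        (\<forall>k. \<forall>s\<in>{-1<..<1}. (D k has_vector_derivative D (Suc k) s) (at s)))"

text \<open>The torus carries its structure as a submanifold of \<open>\<complex>\<^sup>n\<close>, so smoothness of a path is
  smoothness of its real and complex coordinates.\<close>

definition smooth_RT_path ::
    "nat \<Rightarrow> nat \<Rightarrow> (real \<Rightarrow> (nat \<Rightarrow> real) \<times> (nat \<Rightarrow> complex)) \<Rightarrow> bool" where
  "smooth_RT_path d n \<beta> \<longleftrightarrow>
     (\<forall>s\<in>{-1<..<1}. \<beta> s \<in> carrier (RT_group d n)) \<and>
     (\<forall>i<d. smooth_curve (\<lambda>s. fst (\<beta> s) i)) \<and> (\<forall>j<n. smooth_curve (\<lambda>s. snd (\<beta> s) j))"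

text \<open>Values of a path outside \<open>(-1, 1)\<close> are irrelevant.\<close>

definition smooth_paths ::
    "nat \<Rightarrow> nat \<Rightarrow> ((nat \<Rightarrow> real) \<times> (nat \<Rightarrow> complex) \<Rightarrow> 'g \<Rightarrow> complex) \<Rightarrow>
     ('g \<Rightarrow> complex) \<Rightarrow> (real \<Rightarrow> 'g \<Rightarrow> complex) set" where
  "smooth_paths d n \<Phi> \<gamma>\<^sub>0 =
     {\<alpha>. \<alpha> 0 = \<gamma>\<^sub>0 \<and> (\<exists>\<beta>. smooth_RT_path d n \<beta> \<and> (\<forall>s\<in>{-1<..<1}. \<alpha> s = \<Phi> (\<beta> s)))}"

text \<open>Real power with \<open>0\<^sup>0 = 1\<close>, unlike \<open>powr\<close>, where \<open>0 powr 0 = 0\<close>.\<close>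

definition rpow :: "real \<Rightarrow> real \<Rightarrow> real" where
  "rpow x t = (if t = 0 then 1 else x powr t)"

text \<open>When \<open>zero_set \<mu>\<close> is nonempty and \<open>fourier \<mu>\<close> is \<open>C\<^sup>3\<close> at \<open>1\<close>, all suprema are over
  nonempty subsets of \<open>\<real>\<close> bounded by \<open>1\<close>.\<close>

definition t0 ::
    "nat \<Rightarrow> nat \<Rightarrow> ((nat \<Rightarrow> real) \<times> (nat \<Rightarrow> complex) \<Rightarrow> 'g \<Rightarrow> complex) \<Rightarrow>
     'g::topological_ab_group_add measure \<Rightarrow> real" where
  "t0 d n \<Phi> \<mu> =
     (SUP \<gamma>\<^sub>0\<in>zero_set \<mu>. SUP \<alpha>\<in>smooth_paths d n \<Phi> \<gamma>\<^sub>0.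
        Sup {t. t \<ge> 0 \<and>
          Limsup (at_right 0) (\<lambda>s. ereal (inverse s * rpow (cmod (fourier \<mu> (\<alpha> s))) t)) = \<infinity>})"

end

theory Submission
  imports Defs
begin

text \<open>
  Let \<open>f\<close> be the Fourier transform of \<open>\<mu>\<close>, and let \<open>f\<^sup>m = g\<^sup>k\<close>, where \<open>g\<close> is the Fourier transform
  of a probability measure \<open>\<nu>\<close>. Put \<open>q = m / k\<close>, so that \<open>\<bar>f\<bar>\<^sup>q = \<bar>g\<bar>\<close>. The point is that \<open>g\<close> decays at
  least linearly along every smooth path \<open>\<alpha>\<close> that starts in a zero of \<open>f\<close>. Since \<open>\<bar>f\<bar> \<le> 1\<close>, every
  \<open>t > q\<close> then satisfies \<open>\<bar>f (\<alpha> s)\<bar>\<^sup>t \<le> \<bar>g (\<alpha> s)\<bar> \<le> C s\<close>, the upper limit in the definition of \<open>t0\<close>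
  is finite for such \<open>t\<close>, and so the supremum \<open>t0\<close> is at most \<open>q\<close>.

  For the linear decay, a character is regarded as a random variable with values on the unit circle.
  The variance of the character \<open>\<chi>\<close> under \<open>\<mu>\<close> is \<open>1 - \<bar>f \<chi>\<bar>\<^sup>2\<close>, called the deficit below. Three
  facts about it combine:

  \<^item> If \<open>g\<close> vanishes at \<open>\<gamma>\<close>, then \<open>\<bar>g (\<chi> \<gamma>)\<bar>\<^sup>2\<close> is at most the deficit of \<open>\<nu>\<close> at \<open>\<chi>\<close>: subtracting
    from \<open>\<chi>\<close> its mean changes nothing, and Cauchy--Schwarz applies
    (\<open>norm_expectation_mult_orthogonal\<close>).

  \<^item> By Bernoulli's inequality the deficit of \<open>\<nu>\<close> is at most \<open>m\<close> times that of \<open>\<mu>\<close>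
    (\<open>deficit_le_of_power_eq\<close>). Only absolute values enter, so no branch of a root of \<open>f\<close> is chosen.

  \<^item> The deficit of \<open>\<mu>\<close> is at most quadratic near the trivial character. On a coordinate axis this
    is Taylor's theorem, because \<open>\<bar>f\<bar>\<^sup>2\<close> has a maximum there (\<open>deficit_axis_quadratic\<close>). The
    inequality \<open>deficit (\<gamma> \<eta>) \<le> 2 deficit \<gamma> + 2 deficit \<eta>\<close> (\<open>deficit_mult_le\<close>) then passes
    from the axes to all directions, without a chain rule in several variables
    (\<open>deficit_chart_path_quadratic\<close>).

  Taking \<open>\<gamma> = \<alpha> 0\<close> and \<open>\<chi> = \<alpha> s / \<alpha> 0\<close>, whose coordinates are \<open>O(s)\<close>
  (\<open>smooth_RT_path_local_lift\<close>), gives \<open>\<bar>g (\<alpha> s)\<bar>\<^sup>2 = O(s\<^sup>2)\<close>.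
\<close>

section \<open>Unimodular random variables\<close>

context prob_space
begin

lemma integrable_bounded_complex:
  fixes X :: "'a \<Rightarrow> complex"
  assumes "X \<in> borel_measurable M" "\<And>x. cmod (X x) \<le> B"
  shows "integrable M X"
  using assms by (intro integrable_const_bound[where B=B]) auto

lemma unimodular_norm_expectation_le_1:
  fixes X :: "'a \<Rightarrow> complex"
  assumes X: "X \<in> borel_measurable M" "\<And>x. cmod (X x) = 1"
  shows "cmod (LINT x|M. X x) \<le> 1"
proof -
  have "cmod (LINT x|M. X x) \<le> (LINT x|M. cmod (X x))"
    by (rule integral_norm_bound)
  also have "\<dots> = 1" by (simp add: X prob_space)
  finally show ?thesis .
qed

text \<open>The mean square deviation from \<open>c\<close> splits into variance and squared bias. As the second moment
  of a unimodular variable is \<open>1\<close>, the variance depends on the absolute value of the mean alone.\<close>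

lemma unimodular_mean_square_deviation:
  fixes X :: "'a \<Rightarrow> complex"
  assumes X: "X \<in> borel_measurable M" "\<And>x. cmod (X x) = 1"
  defines "a \<equiv> LINT x|M. X x"
  shows "(LINT x|M. (cmod (X x - c))\<^sup>2) = 1 - (cmod a)\<^sup>2 + (cmod (a - c))\<^sup>2"
    and "integrable M (\<lambda>x. (cmod (X x - c))\<^sup>2)"
proof -
  have I: "integrable M X"
    using X by (intro integrable_bounded_complex[where B=1]) auto
  have eq: "(cmod (z - c))\<^sup>2 = 1 + (cmod c)\<^sup>2 - 2 * Re (cnj c * z)" if "cmod z = 1" for z
  proof -
    have "(Re z)\<^sup>2 + (Im z)\<^sup>2 = 1" using that by (simp add: cmod_def)
    then show ?thesis
      unfolding cmod_power2 by (simp add: power2_eq_square algebra_simps)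
  qed
  have eqX: "(\<lambda>x. (cmod (X x - c))\<^sup>2) = (\<lambda>x. 1 + (cmod c)\<^sup>2 - 2 * Re (cnj c * X x))"
    using eq X by auto
  have IR: "integrable M (\<lambda>x. Re (cnj c * X x))"
    using I by (intro integrable_Re integrable_mult_right)
  show "integrable M (\<lambda>x. (cmod (X x - c))\<^sup>2)"
    unfolding eqX using IR
    by (intro Bochner_Integration.integrable_diff integrable_mult_right integrable_const)
  have "(LINT x|M. (cmod (X x - c))\<^sup>2) = 1 + (cmod c)\<^sup>2 - 2 * (LINT x|M. Re (cnj c * X x))"
    unfolding eqX using IR
    by (subst Bochner_Integration.integral_diff) (auto simp: prob_space simp del: times_complex.sel)
  also have "(LINT x|M. Re (cnj c * X x)) = Re (cnj c * a)"
    unfolding a_def using I by (subst integral_Re) auto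
  also have "1 + (cmod c)\<^sup>2 - 2 * Re (cnj c * a) = 1 - (cmod a)\<^sup>2 + (cmod (a - c))\<^sup>2"
    unfolding cmod_power2 by (simp add: power2_eq_square algebra_simps)
  finally show "(LINT x|M. (cmod (X x - c))\<^sup>2) = 1 - (cmod a)\<^sup>2 + (cmod (a - c))\<^sup>2" .
qed

text \<open>As \<open>Y\<close> has mean \<open>0\<close>, the variable \<open>X\<close> may be replaced by \<open>X - a\<close> for any constant \<open>a\<close>. The
  mean of \<open>X\<close> is the constant for which Cauchy--Schwarz gives the best bound, the variance.\<close>

lemma norm_expectation_mult_orthogonal:
  fixes X Y :: "'a \<Rightarrow> complex"
  assumes X: "X \<in> borel_measurable M" "\<And>x. cmod (X x) = 1"
    and Y: "Y \<in> borel_measurable M" "\<And>x. cmod (Y x) = 1"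
    and Y0: "(LINT x|M. Y x) = 0"
  shows "(cmod (LINT x|M. X x * Y x))\<^sup>2 \<le> 1 - (cmod (LINT x|M. X x))\<^sup>2"
proof -
  define a where "a = (LINT x|M. X x)"
  have IXY: "integrable M (\<lambda>x. X x * Y x)"
    using X Y by (intro integrable_bounded_complex[where B=1]) (auto simp: norm_mult)
  have IY: "integrable M Y"
    using Y by (intro integrable_bounded_complex[where B=1]) auto
  have IX: "integrable M X"
    using X by (intro integrable_bounded_complex[where B=1]) auto
  have "(LINT x|M. X x * Y x) = (LINT x|M. X x * Y x) - a * (LINT x|M. Y x)"
    by (simp add: Y0)
  also have "\<dots> = (LINT x|M. (X x - a) * Y x)"
    using IXY IY by (simp add: algebra_simps)
  finally have "cmod (LINT x|M. X x * Y x) \<le> (LINT x|M. cmod ((X x - a) * Y x))"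
    by (metis integral_norm_bound)
  then have le: "cmod (LINT x|M. X x * Y x) \<le> (LINT x|M. cmod (X x - a))"
    by (simp add: norm_mult Y)
  have I1: "integrable M (\<lambda>x. cmod (X x - a))"
    using IX by auto
  have I2: "integrable M (\<lambda>x. (cmod (X x - a))\<^sup>2)"
    and E2: "(LINT x|M. (cmod (X x - a))\<^sup>2) = 1 - (cmod a)\<^sup>2"
    using unimodular_mean_square_deviation[OF X, of a] by (auto simp: a_def)
  have "(LINT x|M. cmod (X x - a))\<^sup>2 \<le> (LINT x|M. (cmod (X x - a))\<^sup>2)"
    using variance_positive[of "\<lambda>x. cmod (X x - a)"] variance_eq[OF I1 I2] by simp
  moreover have "(cmod (LINT x|M. X x * Y x))\<^sup>2 \<le> (LINT x|M. cmod (X x - a))\<^sup>2"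
    using le by (intro power_mono) auto
  ultimately show ?thesis
    using E2 unfolding a_def by linarith
qed

text \<open>Up to a factor, the variance is the square of a distance to the constants, hence almost
  subadditive: the product \<open>a b\<close> of the means is one competitor for the constant closest to \<open>X Y\<close>.\<close>

lemma unimodular_variance_mult_le:
  fixes X Y :: "'a \<Rightarrow> complex"
  assumes X: "X \<in> borel_measurable M" "\<And>x. cmod (X x) = 1"
    and Y: "Y \<in> borel_measurable M" "\<And>x. cmod (Y x) = 1"
  shows "1 - (cmod (LINT x|M. X x * Y x))\<^sup>2
    \<le> 2 * (1 - (cmod (LINT x|M. X x))\<^sup>2) + 2 * (1 - (cmod (LINT x|M. Y x))\<^sup>2)"
proof -
  define a where "a = (LINT x|M. X x)"
  define b where "b = (LINT x|M. Y x)"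
  have a1: "cmod a \<le> 1"
    unfolding a_def by (rule unimodular_norm_expectation_le_1[OF X])
  have XY: "(\<lambda>x. X x * Y x) \<in> borel_measurable M" "\<And>x. cmod (X x * Y x) = 1"
    using X Y by (auto simp: norm_mult)
  note dX = unimodular_mean_square_deviation[OF X, of a, folded a_def]
  note dY = unimodular_mean_square_deviation[OF Y, of b, folded b_def]
  note dXY = unimodular_mean_square_deviation[OF XY, of "a * b"]
  have pointwise: "(cmod (X x * Y x - a * b))\<^sup>2
      \<le> 2 * (cmod (X x - a))\<^sup>2 + 2 * (cmod (Y x - b))\<^sup>2" for x
  proof -
    have "X x * Y x - a * b = (X x - a) * Y x + a * (Y x - b)"
      by (simp add: algebra_simps)
    then have "cmod (X x * Y x - a * b) \<le> cmod (X x - a) + cmod a * cmod (Y x - b)"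
      by (metis norm_triangle_ineq norm_mult Y(2) mult.right_neutral)
    also have "\<dots> \<le> cmod (X x - a) + cmod (Y x - b)"
      using mult_right_mono[OF a1, of "cmod (Y x - b)"] by simp
    finally have "(cmod (X x * Y x - a * b))\<^sup>2 \<le> (cmod (X x - a) + cmod (Y x - b))\<^sup>2"
      by (intro power_mono) auto
    also have "\<dots> \<le> 2 * (cmod (X x - a))\<^sup>2 + 2 * (cmod (Y x - b))\<^sup>2"
      using sum_squares_bound[of "cmod (X x - a)" "cmod (Y x - b)"] by (simp add: power2_sum)
    finally show ?thesis .
  qed
  have "1 - (cmod (LINT x|M. X x * Y x))\<^sup>2 \<le> (LINT x|M. (cmod (X x * Y x - a * b))\<^sup>2)"
    unfolding dXY(1) by simp
  also have "\<dots> \<le> (LINT x|M. 2 * (cmod (X x - a))\<^sup>2 + 2 * (cmod (Y x - b))\<^sup>2)"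
    using dX(2) dY(2) dXY(2) pointwise by (intro integral_mono) auto
  also have "\<dots> = 2 * (1 - (cmod a)\<^sup>2) + 2 * (1 - (cmod b)\<^sup>2)"
    using dX dY by simp
  finally show ?thesis by (simp add: a_def b_def)
qed

end

section \<open>The Fourier transform on characters\<close>

lemma character_measurable:
  assumes "\<gamma> \<in> characters" "sets \<mu> = sets borel"
  shows "\<gamma> \<in> borel_measurable \<mu>"
proof -
  have "\<gamma> \<in> borel_measurable borel"
    using assms by (intro borel_measurable_continuous_onI) (auto simp: characters_def)
  then show ?thesis
    using measurable_cong_sets[OF assms(2) refl] by blast
qed

lemma character_norm: "\<gamma> \<in> characters \<Longrightarrow> cmod (\<gamma> x) = 1"
  by (simp add: characters_def)

text \<open>The variance of the random variable \<open>\<gamma>\<close> under \<open>\<mu>\<close>, when \<open>\<gamma>\<close> is a character.\<close>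

definition deficit :: "'g::topological_ab_group_add measure \<Rightarrow> ('g \<Rightarrow> complex) \<Rightarrow> real" where
  "deficit \<mu> \<gamma> = 1 - (cmod (fourier \<mu> \<gamma>))\<^sup>2"

locale borel_prob_space = prob_space \<mu>
  for \<mu> :: "'g::topological_ab_group_add measure" +
  assumes sets_eq: "sets \<mu> = sets borel"
begin

lemma norm_fourier_le_1: "\<gamma> \<in> characters \<Longrightarrow> cmod (fourier \<mu> \<gamma>) \<le> 1"
  unfolding fourier_def
  by (intro unimodular_norm_expectation_le_1 character_measurable character_norm sets_eq)

lemma deficit_mult_le:
  assumes "\<gamma> \<in> characters" "\<eta> \<in> characters"
  shows "deficit \<mu> (\<lambda>x. \<gamma> x * \<eta> x) \<le> 2 * deficit \<mu> \<gamma> + 2 * deficit \<mu> \<eta>"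
  unfolding deficit_def fourier_def using assms
  by (intro unimodular_variance_mult_le character_measurable character_norm sets_eq)

lemma norm_fourier_translate_zero:
  assumes "\<gamma> \<in> characters" "\<eta> \<in> characters" "fourier \<mu> \<eta> = 0"
  shows "(cmod (fourier \<mu> (\<lambda>x. \<gamma> x * \<eta> x)))\<^sup>2 \<le> deficit \<mu> \<gamma>"
  using assms unfolding deficit_def fourier_def
  by (intro norm_expectation_mult_orthogonal character_measurable character_norm sets_eq)

lemma fourier_trivial: "fourier \<mu> (\<lambda>_. 1) = 1"
  by (simp add: fourier_def prob_space)

end

text \<open>With \<open>x = \<bar>u\<bar>\<^sup>2\<close> and \<open>z = \<bar>v\<bar>\<^sup>2\<close> this is \<open>1 - x \<le> 1 - x\<^sup>k = 1 - z\<^sup>m \<le> m (1 - z)\<close>, where the last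
  step is Bernoulli's inequality.\<close>

lemma deficit_le_of_power_eq:
  fixes u v :: complex
  assumes "v ^ m = u ^ k" "cmod u \<le> 1" "k \<ge> 1"
  shows "1 - (cmod u)\<^sup>2 \<le> real m * (1 - (cmod v)\<^sup>2)"
proof -
  have "((cmod u)\<^sup>2) ^ k = ((cmod v)\<^sup>2) ^ m"
    by (metis assms(1) norm_power power_mult mult.commute)
  moreover have "((cmod u)\<^sup>2) ^ k \<le> (cmod u)\<^sup>2"
    using power_decreasing[of 1 k "(cmod u)\<^sup>2"] assms by (simp add: power_le_one)
  moreover have "1 + real m * ((cmod v)\<^sup>2 - 1) \<le> (1 + ((cmod v)\<^sup>2 - 1)) ^ m"
    by (rule Bernoulli_inequality) simp
  ultimately show ?thesis by (simp add: algebra_simps)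
qed

section \<open>One-dimensional calculus\<close>

lemma has_vector_derivative_imp_linear_bound:
  fixes f :: "real \<Rightarrow> 'b::real_normed_vector"
  assumes "(f has_vector_derivative D) (at a)"
  shows "\<exists>C\<ge>0. \<forall>\<^sub>F s in nhds a. norm (f s - f a) \<le> C * \<bar>s - a\<bar>"
proof (intro exI[of _ "norm D + 1"] conjI)
  have "((\<lambda>s. (f s - f a - (s - a) *\<^sub>R D) /\<^sub>R norm (s - a)) \<longlongrightarrow> 0) (at a)"
    using assms unfolding has_vector_derivative_def has_derivative_at_within by simp
  then have "\<forall>\<^sub>F s in at a. norm ((f s - f a - (s - a) *\<^sub>R D) /\<^sub>R norm (s - a)) < 1"
    by (auto simp: tendsto_iff)
  then have "\<forall>\<^sub>F s in at a. norm (f s - f a) \<le> (norm D + 1) * \<bar>s - a\<bar>"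
    using eventually_neq_at_within[of a a UNIV]
  proof eventually_elim
    case (elim s)
    define v where "v = f s - f a - (s - a) *\<^sub>R D"
    have "norm v / \<bar>s - a\<bar> < 1"
      using elim(1) unfolding v_def[symmetric] by (simp add: divide_inverse_commute)
    then have "norm (f s - f a - (s - a) *\<^sub>R D) \<le> \<bar>s - a\<bar>"
      using elim(2) by (simp add: v_def pos_divide_less_eq)
    then have "norm (f s - f a) \<le> \<bar>s - a\<bar> + norm ((s - a) *\<^sub>R D)"
      using norm_triangle_ineq2[of "f s - f a" "(s - a) *\<^sub>R D"] by linarith
    then show ?case by (simp add: distrib_right distrib_left mult.commute)
  qed
  then show "\<forall>\<^sub>F s in nhds a. norm (f s - f a) \<le> (norm D + 1) * \<bar>s - a\<bar>"
    by (auto simp: eventually_at_filter elim: eventually_mono)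
qed simp

text \<open>The derivative of \<open>\<bar>\<phi>\<bar>\<^sup>2\<close> vanishes at the maximum \<open>0\<close> and is differentiable there, so it is
  \<open>O(t)\<close>; the mean value theorem gives one more order.\<close>

lemma norm_square_peak_quadratic:
  fixes \<phi> \<phi>' :: "real \<Rightarrow> complex"
  assumes d1: "\<forall>\<^sub>F t in nhds 0. (\<phi> has_vector_derivative \<phi>' t) (at t)"
    and d2: "(\<phi>' has_vector_derivative p) (at 0)"
    and peak: "\<And>t. cmod (\<phi> t) \<le> 1" "cmod (\<phi> 0) = 1"
  shows "\<exists>C\<ge>0. \<forall>\<^sub>F t in nhds 0. 1 - (cmod (\<phi> t))\<^sup>2 \<le> C * t\<^sup>2"
proof -
  define h where "h t = (cmod (\<phi> t))\<^sup>2" for t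
  define h' where "h' t = 2 * inner (\<phi> t) (\<phi>' t)" for t
  have h_deriv: "(h has_real_derivative h' t) (at t)"
    if "(\<phi> has_vector_derivative \<phi>' t) (at t)" for t
  proof -
    have "((\<lambda>t. inner (\<phi> t) (\<phi> t)) has_derivative
        (\<lambda>s. inner (\<phi> t) (s *\<^sub>R \<phi>' t) + inner (s *\<^sub>R \<phi>' t) (\<phi> t))) (at t)"
      using that unfolding has_vector_derivative_def by (intro has_derivative_inner)
    then show ?thesis
      unfolding h_def[abs_def] h'_def has_field_derivative_def power2_norm_eq_inner
      by (rule has_derivative_eq_rhs) (auto simp: inner_commute algebra_simps)
  qed
  have d10: "(\<phi> has_vector_derivative \<phi>' 0) (at 0)"
    using d1 by (rule eventually_nhds_x_imp_x)
  have h'0: "h' 0 = 0"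
    using DERIV_local_max[OF h_deriv[OF d10], of 1] peak by (simp add: h_def power_le_one)
  have "((\<lambda>t. inner (\<phi> t) (\<phi>' t)) has_derivative
      (\<lambda>s. inner (\<phi> 0) (s *\<^sub>R p) + inner (s *\<^sub>R \<phi>' 0) (\<phi>' 0))) (at 0)"
    using d10 d2 unfolding has_vector_derivative_def by (intro has_derivative_inner)
  then have "((\<lambda>t. inner (\<phi> t) (\<phi>' t)) has_vector_derivative
      (inner (\<phi> 0) p + inner (\<phi>' 0) (\<phi>' 0))) (at 0)"
    unfolding has_vector_derivative_def
    by (rule has_derivative_eq_rhs) (auto simp: algebra_simps)
  then have "(h' has_vector_derivative 2 * (inner (\<phi> 0) p + inner (\<phi>' 0) (\<phi>' 0))) (at 0)"
    unfolding h'_def[abs_def] by (intro has_vector_derivative_mult_right)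
  from has_vector_derivative_imp_linear_bound[OF this] obtain C where
    C: "C \<ge> 0" "\<forall>\<^sub>F t in nhds 0. \<bar>h' t\<bar> \<le> C * \<bar>t\<bar>"
    by (auto simp: h'0)
  from eventually_conj[OF C(2) d1] obtain \<delta> where \<delta>: "\<delta> > 0"
    "\<And>t. \<bar>t\<bar> < \<delta> \<Longrightarrow> \<bar>h' t\<bar> \<le> C * \<bar>t\<bar> \<and> (\<phi> has_vector_derivative \<phi>' t) (at t)"
    unfolding eventually_nhds_metric by (auto simp: dist_real_def)
  have "1 - (cmod (\<phi> t))\<^sup>2 \<le> C * t\<^sup>2" if t: "\<bar>t\<bar> < \<delta>" for t
  proof (cases "t = 0")
    case False
    have "\<exists>z. \<bar>z\<bar> \<le> \<bar>t\<bar> \<and> h t - h 0 = t * h' z"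
    proof (cases "t > 0")
      case True
      have "\<exists>z>0. z < t \<and> h t - h 0 = (t - 0) * h' z"
        using True t by (intro MVT2 h_deriv) (use \<delta>(2) in auto)
      then obtain z where "z > 0" "z < t" "h t - h 0 = t * h' z" by auto
      then show ?thesis by (intro exI[of _ z]) auto
    next
      case False
      have "\<exists>z>t. z < 0 \<and> h 0 - h t = (0 - t) * h' z"
        using False \<open>t \<noteq> 0\<close> t by (intro MVT2 h_deriv) (use \<delta>(2) in auto)
      then obtain z where "z > t" "z < 0" "h 0 - h t = - t * h' z" by auto
      then show ?thesis by (intro exI[of _ z]) auto
    qed
    then obtain z where z: "\<bar>z\<bar> \<le> \<bar>t\<bar>" "h t - h 0 = t * h' z" by blast
    have "\<bar>h t - h 0\<bar> = \<bar>t\<bar> * \<bar>h' z\<bar>" using z by (simp add: abs_mult)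
    also have "\<dots> \<le> \<bar>t\<bar> * (C * \<bar>t\<bar>)"
      using \<delta>(2)[of z] z t C(1) mult_left_mono[OF z(1) C(1)]
      by (intro mult_left_mono) auto
    also have "\<dots> = C * t\<^sup>2" by (simp add: power2_eq_square)
    finally show ?thesis using peak by (simp add: h_def)
  qed (use peak in simp)
  then have "\<forall>\<^sub>F t in nhds 0. 1 - (cmod (\<phi> t))\<^sup>2 \<le> C * t\<^sup>2"
    unfolding eventually_nhds_metric using \<delta>(1) by (auto simp: dist_real_def)
  then show ?thesis using C(1) by blast
qed

section \<open>The covering of the group\<close>

lemma RT_chart_in_carrier: "RT_chart d n y \<in> carrier (RT_group d n)"
  by (auto simp: RT_chart_def RT_group_def real_group_def circle_group_def)

lemma RT_chart_add:
  "RT_chart d n (\<lambda>i. y i + z i) = RT_chart d n y \<otimes>\<^bsub>RT_group d n\<^esub> RT_chart d n z"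
  by (auto simp: RT_chart_def RT_group_def real_group_def circle_group_def cis_mult fun_eq_iff)

lemma RT_chart_cong:
  "(\<And>i. i < d + n \<Longrightarrow> y i = z i) \<Longrightarrow> RT_chart d n y = RT_chart d n z"
  by (auto simp: RT_chart_def fun_eq_iff)

abbreviation axis_point :: "nat \<Rightarrow> nat \<Rightarrow> real \<Rightarrow> nat \<Rightarrow> real" where
  "axis_point N i t \<equiv> (\<lambda>j\<in>{..<N}. 0)(i := t)"

lemma axis_point_eventually_in_open:
  assumes U: "openin (product_topology (\<lambda>_. euclideanreal) {..<N}) U"
    and "(\<lambda>i\<in>{..<N}. 0) \<in> U" "i < N"
  shows "\<forall>\<^sub>F t in nhds 0. axis_point N i t \<in> U"
proof -
  have "continuous_map euclideanreal (product_topology (\<lambda>_. euclideanreal) {..<N}) (axis_point N i)"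
    using \<open>i < N\<close> by (auto simp: continuous_map_componentwise extensional_def)
  then have "open {t. axis_point N i t \<in> U}"
    using openin_continuous_map_preimage[OF _ U] by fastforce
  moreover have "axis_point N i 0 = (\<lambda>i\<in>{..<N}. 0)"
    using \<open>i < N\<close> by auto
  ultimately show ?thesis
    using assms(2) unfolding eventually_nhds by (intro exI[of _ "{t. axis_point N i t \<in> U}"]) auto
qed

lemma Ck_on_imp_axis_derivatives:
  assumes U: "openin (product_topology (\<lambda>_. euclideanreal) {..<N}) U"
    and z: "(\<lambda>i\<in>{..<N}. 0) \<in> U" and "Ck_on N (Suc (Suc k)) U f" "i < N"
  obtains \<phi>' p where
    "\<forall>\<^sub>F t in nhds 0. ((\<lambda>t. f (axis_point N i t)) has_vector_derivative \<phi>' t) (at t)"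
    "(\<phi>' has_vector_derivative p) (at 0)"
proof -
  from assms obtain g where g:
    "\<forall>y\<in>U. ((\<lambda>t. f (y(i := t))) has_vector_derivative g y) (at (y i))" "Ck_on N (Suc k) U g"
    by auto
  from g(2) \<open>i < N\<close> obtain g2 where g2:
    "\<forall>y\<in>U. ((\<lambda>t. g (y(i := t))) has_vector_derivative g2 y) (at (y i))"
    by auto
  note ev = axis_point_eventually_in_open[OF U z \<open>i < N\<close>]
  show thesis
  proof (rule that[of "\<lambda>t. g (axis_point N i t)" "g2 (axis_point N i 0)"])
    show "\<forall>\<^sub>F t in nhds 0.
        ((\<lambda>t. f (axis_point N i t)) has_vector_derivative g (axis_point N i t)) (at t)"
      using ev by eventually_elim (use g(1) in force)
    show "((\<lambda>t. g (axis_point N i t)) has_vector_derivative g2 (axis_point N i 0)) (at 0)"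
      using bspec[OF g2 eventually_nhds_x_imp_x[OF ev]] by simp
  qed
qed

lemma smooth_curve_linear_bound:
  assumes "smooth_curve c"
  shows "\<exists>C\<ge>0. \<forall>\<^sub>F s in at_right 0. norm (c s - c 0) \<le> C * s"
proof -
  obtain D where "(c has_vector_derivative D) (at 0)"
    using assms unfolding smooth_curve_def by fastforce
  from has_vector_derivative_imp_linear_bound[OF this] obtain C where
    C: "C \<ge> 0" "\<forall>\<^sub>F s in nhds 0. norm (c s - c 0) \<le> C * \<bar>s\<bar>"
    by auto
  have "\<forall>\<^sub>F s in at_right 0. norm (c s - c 0) \<le> C * s"
    using filter_leD[OF at_within_le_nhds C(2)] eventually_at_right_less[of 0] by eventually_elim simp
  then show ?thesis using C(1) by blast
qed

text \<open>\<open>c s * cnj (c 0)\<close> is the quotient of two points of the circle. It starts at \<open>1\<close>, where the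
  principal logarithm is differentiable; \<open>Arg\<close> is its imaginary part.\<close>

lemma smooth_circle_curve_angle_bound:
  assumes "smooth_curve c" "cmod (c 0) = 1"
  shows "\<exists>C\<ge>0. \<forall>\<^sub>F s in at_right 0. \<bar>Arg (c s * cnj (c 0))\<bar> \<le> C * s"
proof -
  obtain D where D: "(c has_vector_derivative D) (at 0)"
    using assms unfolding smooth_curve_def by fastforce
  have one: "c 0 * cnj (c 0) = 1"
    using assms(2) by (simp add: complex_norm_square[symmetric])
  have d1: "((\<lambda>s. c s * cnj (c 0)) has_vector_derivative D * cnj (c 0)) (at 0)"
    by (rule has_vector_derivative_mult_left[OF D])
  have "((Ln \<circ> (\<lambda>s. c s * cnj (c 0))) has_vector_derivative (D * cnj (c 0) * inverse 1)) (at 0)"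
    by (rule field_vector_diff_chain_at[OF d1]) (auto simp: one intro!: derivative_eq_intros)
  from has_vector_derivative_imp_linear_bound[OF this] obtain C where
    C: "C \<ge> 0" "\<forall>\<^sub>F s in nhds 0. cmod (Ln (c s * cnj (c 0))) \<le> C * \<bar>s\<bar>"
    by (auto simp: one)
  have "\<forall>\<^sub>F s in at_right 0. \<bar>Arg (c s * cnj (c 0))\<bar> \<le> C * s"
    using filter_leD[OF at_within_le_nhds C(2)] eventually_at_right_less[of 0]
  proof eventually_elim
    case (elim s)
    show ?case
    proof (cases "c s * cnj (c 0) = 0")
      case True
      show ?thesis unfolding True using elim C(1) by (simp add: Arg_zero)
    next
      case False
      then show ?thesis
        using elim abs_Im_le_cmod[of "Ln (c s * cnj (c 0))"] by (simp add: Arg_eq_Im_Ln)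
    qed
  qed
  then show ?thesis using C(1) by blast
qed

text \<open>The displacement of a path from its starting point in real coordinates. The principal argument
  makes the factorization hold on all of \<open>(-1, 1)\<close>; the lift may jump when the quotient crosses
  \<open>-1\<close>, but only its size near \<open>s = 0\<close> matters.\<close>

lemma smooth_RT_path_local_lift:
  assumes "smooth_RT_path d n \<beta>"
  obtains y where
    "\<And>s. s \<in> {-1<..<1} \<Longrightarrow> \<beta> s = RT_chart d n (y s) \<otimes>\<^bsub>RT_group d n\<^esub> \<beta> 0"
    "\<And>i. i < d + n \<Longrightarrow> \<exists>C\<ge>0. \<forall>\<^sub>F s in at_right 0. \<bar>y s i\<bar> \<le> C * s"
proof -
  define y where "y s i = (if i < d then fst (\<beta> s) i - fst (\<beta> 0) i
    else Arg (snd (\<beta> s) (i - d) * cnj (snd (\<beta> 0) (i - d))))" for s i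
  have carrier: "fst (\<beta> s) \<in> extensional {..<d}" "snd (\<beta> s) \<in> extensional {..<n}"
    "\<And>j. j < n \<Longrightarrow> cmod (snd (\<beta> s) j) = 1" if "s \<in> {-1<..<1}" for s
    using assms that
    by (auto simp: smooth_RT_path_def RT_group_def circle_group_def mem_Times_iff PiE_iff)
  show thesis
  proof (rule that[of y])
    fix s :: real assume s: "s \<in> {-1<..<1}"
    have "cis (y s (d + j)) * snd (\<beta> 0) j = snd (\<beta> s) j" if "j < n" for j
    proof -
      let ?z = "snd (\<beta> s) j * cnj (snd (\<beta> 0) j)"
      have n1: "cmod (snd (\<beta> s) j) = 1" "cmod (snd (\<beta> 0) j) = 1"
        using carrier(3) s that by auto
      then have "cmod ?z = 1" by (simp add: norm_mult)
      then have "cis (Arg ?z) = ?z"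
        by (subst cis_Arg) (auto simp: sgn_div_norm)
      moreover have "cnj (snd (\<beta> 0) j) * snd (\<beta> 0) j = 1"
        using n1 by (metis complex_norm_square mult.commute of_real_1 power_one)
      ultimately show ?thesis by (simp add: y_def mult.assoc)
    qed
    then show "\<beta> s = RT_chart d n (y s) \<otimes>\<^bsub>RT_group d n\<^esub> \<beta> 0"
      using carrier[OF s]
      by (cases "\<beta> s"; cases "\<beta> 0")
        (auto simp: RT_chart_def RT_group_def real_group_def circle_group_def y_def fun_eq_iff
          extensional_def)
  next
    fix i assume i: "i < d + n"
    show "\<exists>C\<ge>0. \<forall>\<^sub>F s in at_right 0. \<bar>y s i\<bar> \<le> C * s"
    proof (cases "i < d")
      case True
      then show ?thesis
        using smooth_curve_linear_bound[of "\<lambda>s. fst (\<beta> s) i"] assms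
        by (simp add: smooth_RT_path_def y_def)
    next
      case False
      then have "i - d < n" using i by simp
      then show ?thesis
        using smooth_circle_curve_angle_bound[of "\<lambda>s. snd (\<beta> s) (i - d)"] assms carrier(3)[of 0] False
        by (simp add: smooth_RT_path_def y_def)
    qed
  qed
qed

section \<open>Decay of characteristic functions along smooth paths\<close>

locale RT_dual_measure = borel_prob_space \<mu>
  for \<mu> :: "'g::topological_ab_group_add measure" +
  fixes d n :: nat and \<Phi> :: "(nat \<Rightarrow> real) \<times> (nat \<Rightarrow> complex) \<Rightarrow> 'g \<Rightarrow> complex"
  assumes hom: "\<Phi> \<in> hom (RT_group d n) dual_group"
begin

lemma \<Phi>_character: "x \<in> carrier (RT_group d n) \<Longrightarrow> \<Phi> x \<in> characters"
  using hom by (auto simp: hom_def dual_group_def)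

lemma \<Phi>_mult:
  "x \<in> carrier (RT_group d n) \<Longrightarrow> y \<in> carrier (RT_group d n) \<Longrightarrow>
    \<Phi> (x \<otimes>\<^bsub>RT_group d n\<^esub> y) = (\<lambda>g. \<Phi> x g * \<Phi> y g)"
  using hom by (auto simp: hom_def dual_group_def)

text \<open>The character satisfies \<open>\<gamma> = \<gamma> \<gamma>\<close> and has no zeros.\<close>

lemma \<Phi>_chart_zero: "\<Phi> (RT_chart d n (\<lambda>_. 0)) = (\<lambda>_. 1)"
proof
  fix g
  let ?\<gamma> = "\<Phi> (RT_chart d n (\<lambda>_. 0))"
  have "?\<gamma> = (\<lambda>g. ?\<gamma> g * ?\<gamma> g)"
    using RT_chart_add[of d n "\<lambda>_. 0" "\<lambda>_. 0"]
      \<Phi>_mult[OF RT_chart_in_carrier RT_chart_in_carrier, of "\<lambda>_. 0" "\<lambda>_. 0"]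
    by (simp only: add_0_left)
  then have "?\<gamma> g = ?\<gamma> g * ?\<gamma> g" by metis
  moreover have "?\<gamma> g \<noteq> 0"
    using character_norm[OF \<Phi>_character[OF RT_chart_in_carrier[of d n "\<lambda>_. 0"]], of g] by auto
  ultimately show "?\<gamma> g = 1" by simp
qed

text \<open>The transform has absolute value \<open>1\<close> at the trivial character and at most \<open>1\<close> elsewhere, so
  the one-dimensional estimate applies on each axis.\<close>

lemma deficit_axis_quadratic:
  assumes "C3_at_one d n \<Phi> (fourier \<mu>)" "i < d + n"
  shows "\<exists>C\<ge>0. \<forall>\<^sub>F t in nhds 0.
    deficit \<mu> (\<Phi> (RT_chart d n (axis_point (d + n) i t))) \<le> C * t\<^sup>2"
proof -
  let ?f = "\<lambda>y. fourier \<mu> (\<Phi> (RT_chart d n y))"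
  have three: "(3::nat) = Suc (Suc 1)" by simp
  obtain U where U:
    "openin (product_topology (\<lambda>_. euclideanreal) {..<d + n}) U"
    "(\<lambda>i\<in>{..<d + n}. 0) \<in> U" "Ck_on (d + n) (Suc (Suc 1)) U ?f"
    using assms(1) unfolding C3_at_one_def three by blast
  have "RT_chart d n (axis_point (d + n) i 0) = RT_chart d n (\<lambda>_. 0)"
    by (rule RT_chart_cong) simp
  then have eq: "cmod (?f (axis_point (d + n) i 0)) = 1"
    using \<Phi>_chart_zero fourier_trivial by simp
  have le: "cmod (?f (axis_point (d + n) i t)) \<le> 1" for t
    by (intro norm_fourier_le_1 \<Phi>_character RT_chart_in_carrier)
  obtain \<phi>' p where "\<forall>\<^sub>F t in nhds 0.
      ((\<lambda>t. ?f (axis_point (d + n) i t)) has_vector_derivative \<phi>' t) (at t)"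
    "(\<phi>' has_vector_derivative p) (at 0)"
    by (rule Ck_on_imp_axis_derivatives[OF U assms(2)])
  from norm_square_peak_quadratic[OF this le eq] show ?thesis
    unfolding deficit_def .
qed

text \<open>The character at \<open>y s\<close> is the product of the characters at its coordinate projections. The
  induction adds one coordinate at a time; the constant at most doubles
  in each step, apart from the contribution of the new axis.\<close>

lemma deficit_chart_path_quadratic:
  assumes C3: "C3_at_one d n \<Phi> (fourier \<mu>)"
    and y: "\<And>i. i < d + n \<Longrightarrow> \<exists>C\<ge>0. \<forall>\<^sub>F s in at_right 0. \<bar>y s i\<bar> \<le> C * s"
  shows "\<exists>C. \<forall>\<^sub>F s in at_right 0. deficit \<mu> (\<Phi> (RT_chart d n (y s))) \<le> C * s\<^sup>2"
proof -
  have axis: "\<exists>C. \<forall>\<^sub>F s in at_right 0.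
      deficit \<mu> (\<Phi> (RT_chart d n (axis_point (d + n) i (y s i)))) \<le> C * s\<^sup>2"
    if i: "i < d + n" for i
  proof -
    from y[OF i] obtain A where A: "A \<ge> 0" "\<forall>\<^sub>F s in at_right 0. \<bar>y s i\<bar> \<le> A * s" by blast
    from deficit_axis_quadratic[OF C3 i] obtain B where B: "B \<ge> 0" "\<forall>\<^sub>F t in nhds 0.
        deficit \<mu> (\<Phi> (RT_chart d n (axis_point (d + n) i t))) \<le> B * t\<^sup>2" by blast
    have "((\<lambda>s. A * s) \<longlongrightarrow> 0) (at_right 0)"
      using tendsto_mult_right_zero[OF tendsto_ident_at[of 0 "{0<..}"], of A] .
    then have "((\<lambda>s. y s i) \<longlongrightarrow> 0) (at_right 0)"
      using A(2) Lim_null_comparison[of "\<lambda>s. y s i" "\<lambda>s. A * s" "at_right 0"] by simp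
    then have "\<forall>\<^sub>F s in at_right 0.
        deficit \<mu> (\<Phi> (RT_chart d n (axis_point (d + n) i (y s i)))) \<le> B * (y s i)\<^sup>2"
      by (rule eventually_compose_filterlim[OF B(2)])
    with A(2) have "\<forall>\<^sub>F s in at_right 0.
        deficit \<mu> (\<Phi> (RT_chart d n (axis_point (d + n) i (y s i)))) \<le> (B * A\<^sup>2) * s\<^sup>2"
    proof eventually_elim
      case (elim s)
      have "(y s i)\<^sup>2 \<le> (A * s)\<^sup>2"
        using power_mono[OF elim(1), of 2] by simp
      from mult_left_mono[OF this B(1)] elim(2) show ?case
        by (simp add: power_mult_distrib)
    qed
    then show ?thesis by blast
  qed
  have "\<exists>C. \<forall>\<^sub>F s in at_right 0.
      deficit \<mu> (\<Phi> (RT_chart d n (\<lambda>i. if i < j then y s i else 0))) \<le> C * s\<^sup>2"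
    if "j \<le> d + n" for j
    using that
  proof (induction j)
    case 0
    show ?case
      using \<Phi>_chart_zero fourier_trivial by (intro exI[of _ 0]) (simp add: deficit_def)
  next
    case (Suc j)
    then obtain A B where
      A: "\<forall>\<^sub>F s in at_right 0.
        deficit \<mu> (\<Phi> (RT_chart d n (\<lambda>i. if i < j then y s i else 0))) \<le> A * s\<^sup>2" and
      B: "\<forall>\<^sub>F s in at_right 0.
        deficit \<mu> (\<Phi> (RT_chart d n (axis_point (d + n) j (y s j)))) \<le> B * s\<^sup>2"
      using axis[of j] by auto
    have "\<forall>\<^sub>F s in at_right 0. deficit \<mu> (\<Phi> (RT_chart d n
        (\<lambda>i. if i < Suc j then y s i else 0))) \<le> (2 * A + 2 * B) * s\<^sup>2"
      using A B
    proof eventually_elim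
      case (elim s)
      let ?y = "\<lambda>i. if i < j then y s i else 0" and ?e = "axis_point (d + n) j (y s j)"
      have "RT_chart d n (\<lambda>i. if i < Suc j then y s i else 0) = RT_chart d n (\<lambda>i. ?y i + ?e i)"
        by (rule RT_chart_cong) (auto simp: less_Suc_eq)
      then have "\<Phi> (RT_chart d n (\<lambda>i. if i < Suc j then y s i else 0))
          = (\<lambda>g. \<Phi> (RT_chart d n ?y) g * \<Phi> (RT_chart d n ?e) g)"
        by (simp only: RT_chart_add \<Phi>_mult RT_chart_in_carrier)
      then have "deficit \<mu> (\<Phi> (RT_chart d n (\<lambda>i. if i < Suc j then y s i else 0)))
          \<le> 2 * deficit \<mu> (\<Phi> (RT_chart d n ?y)) + 2 * deficit \<mu> (\<Phi> (RT_chart d n ?e))"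
        by (simp only: deficit_mult_le \<Phi>_character RT_chart_in_carrier)
      with elim show ?case by (simp add: algebra_simps)
    qed
    then show ?case by blast
  qed
  from this[of "d + n"] obtain C where C: "\<forall>\<^sub>F s in at_right 0.
      deficit \<mu> (\<Phi> (RT_chart d n (\<lambda>i. if i < d + n then y s i else 0))) \<le> C * s\<^sup>2" by blast
  have "RT_chart d n (\<lambda>i. if i < d + n then y s i else 0) = RT_chart d n (y s)" for s
    by (rule RT_chart_cong) simp
  from C[unfolded this] show ?thesis by blast
qed

text \<open>The value of the transform of \<open>\<nu>\<close> at \<open>\<alpha> s\<close> is controlled by the quotient \<open>\<alpha> s / \<gamma>\<^sub>0\<close>, thus by
  the behaviour of the transform of \<open>\<mu>\<close> near the trivial character.\<close>

lemma root_transform_path_linear: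
  assumes C3: "C3_at_one d n \<Phi> (fourier \<mu>)"
    and \<nu>: "borel_prob_space \<nu>" and "k \<ge> 1" "m \<ge> 1"
    and root: "\<forall>\<gamma>\<in>characters. fourier \<mu> \<gamma> ^ m = fourier \<nu> \<gamma> ^ k"
    and \<gamma>0: "\<gamma>\<^sub>0 \<in> zero_set \<mu>" and \<alpha>: "\<alpha> \<in> smooth_paths d n \<Phi> \<gamma>\<^sub>0"
  shows "\<exists>C. \<forall>\<^sub>F s in at_right 0. \<alpha> s \<in> characters \<and> cmod (fourier \<nu> (\<alpha> s)) \<le> C * s"
proof -
  interpret \<nu>: borel_prob_space \<nu> by fact
  from \<alpha> obtain \<beta> where \<beta>: "smooth_RT_path d n \<beta>" "\<And>s. s \<in> {-1<..<1} \<Longrightarrow> \<alpha> s = \<Phi> (\<beta> s)"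
    and \<alpha>0: "\<alpha> 0 = \<gamma>\<^sub>0"
    unfolding smooth_paths_def by blast
  have car: "\<beta> s \<in> carrier (RT_group d n)" if "s \<in> {-1<..<1}" for s
    using \<beta>(1) that unfolding smooth_RT_path_def by blast
  have \<beta>0: "\<Phi> (\<beta> 0) = \<gamma>\<^sub>0" using \<beta>(2)[of 0] \<alpha>0 by simp
  from \<gamma>0 have zero: "\<gamma>\<^sub>0 \<in> characters" "fourier \<nu> \<gamma>\<^sub>0 = 0"
    using root \<open>m \<ge> 1\<close> unfolding zero_set_def by (auto simp: power_0_left dest!: bspec)
  from smooth_RT_path_local_lift[OF \<beta>(1)] obtain y where
    y: "\<And>s. s \<in> {-1<..<1} \<Longrightarrow> \<beta> s = RT_chart d n (y s) \<otimes>\<^bsub>RT_group d n\<^esub> \<beta> 0"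
    "\<And>i. i < d + n \<Longrightarrow> \<exists>C\<ge>0. \<forall>\<^sub>F s in at_right 0. \<bar>y s i\<bar> \<le> C * s" by blast
  from deficit_chart_path_quadratic[of y, OF C3 y(2)] obtain C where
    C: "\<forall>\<^sub>F s in at_right 0. deficit \<mu> (\<Phi> (RT_chart d n (y s))) \<le> C * s\<^sup>2" by blast
  have "\<forall>\<^sub>F s in at_right 0. \<alpha> s \<in> characters \<and> cmod (fourier \<nu> (\<alpha> s)) \<le> sqrt (real m * C) * s"
    using C eventually_at_right_real[of 0 1, OF zero_less_one]
  proof eventually_elim
    case (elim s)
    let ?\<chi> = "\<Phi> (RT_chart d n (y s))"
    have \<chi>: "?\<chi> \<in> characters" by (intro \<Phi>_character RT_chart_in_carrier)
    have s: "s \<in> {-1<..<1}" "0 < s" using elim by auto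
    have "\<alpha> s = (\<lambda>g. ?\<chi> g * \<gamma>\<^sub>0 g)"
      using y(1)[OF s(1)] \<beta>(2)[OF s(1)] \<beta>0 car[of 0] \<Phi>_mult[OF RT_chart_in_carrier, of "\<beta> 0"]
      by simp
    then have "(cmod (fourier \<nu> (\<alpha> s)))\<^sup>2 \<le> deficit \<nu> ?\<chi>"
      using \<nu>.norm_fourier_translate_zero[OF \<chi> zero] by simp
    also have "\<dots> \<le> real m * deficit \<mu> ?\<chi>"
      unfolding deficit_def using root \<chi> \<nu>.norm_fourier_le_1 \<open>k \<ge> 1\<close>
      by (intro deficit_le_of_power_eq) auto
    also have "\<dots> \<le> (real m * C) * s\<^sup>2"
      using mult_left_mono[OF elim(1), of "real m"] by simp
    finally have "sqrt ((cmod (fourier \<nu> (\<alpha> s)))\<^sup>2) \<le> sqrt ((real m * C) * s\<^sup>2)"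
      by (rule real_sqrt_le_mono)
    moreover have "\<alpha> s \<in> characters"
      using \<beta>(2) car s \<Phi>_character by simp
    ultimately show ?case using s by (simp add: real_sqrt_mult)
  qed
  then show ?thesis by blast
qed

lemma admissible_exponent_le:
  assumes C3: "C3_at_one d n \<Phi> (fourier \<mu>)"
    and \<nu>: "borel_prob_space \<nu>" and km: "k \<ge> 1" "m \<ge> 1"
    and root: "\<forall>\<gamma>\<in>characters. fourier \<mu> \<gamma> ^ m = fourier \<nu> \<gamma> ^ k"
    and \<gamma>0: "\<gamma>\<^sub>0 \<in> zero_set \<mu>" and \<alpha>: "\<alpha> \<in> smooth_paths d n \<Phi> \<gamma>\<^sub>0"
    and lim: "Limsup (at_right 0) (\<lambda>s. ereal (inverse s * rpow (cmod (fourier \<mu> (\<alpha> s))) t)) = \<infinity>"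
  shows "t \<le> real m / real k"
proof (rule ccontr)
  define q where "q = real m / real k"
  assume "\<not> t \<le> real m / real k"
  then have t: "q < t" by (simp add: q_def)
  have q: "0 < q" using km by (simp add: q_def)
  from root_transform_path_linear[OF C3 \<nu> km root \<gamma>0 \<alpha>] obtain C where
    C: "\<forall>\<^sub>F s in at_right 0. \<alpha> s \<in> characters \<and> cmod (fourier \<nu> (\<alpha> s)) \<le> C * s" by blast
  have "\<forall>\<^sub>F s in at_right 0. ereal (inverse s * rpow (cmod (fourier \<mu> (\<alpha> s))) t) \<le> ereal C"
    using C eventually_at_right_less[of 0]
  proof eventually_elim
    case (elim s)
    let ?x = "cmod (fourier \<mu> (\<alpha> s))" and ?u = "cmod (fourier \<nu> (\<alpha> s))"
    have x1: "?x \<le> 1" using elim norm_fourier_le_1 by blast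
    have eq: "?x ^ m = ?u ^ k" using elim root by (metis norm_power)
    have "rpow ?x t = ?x powr t" using t q by (simp add: rpow_def)
    also have "\<dots> \<le> ?x powr q"
      using x1 t by (cases "?x = 0") (auto intro: powr_mono')
    also have "\<dots> = ?u"
    proof (cases "?x = 0")
      case True
      then have "?u ^ k = 0" using eq km by (simp add: power_0_left)
      then show ?thesis using True by simp
    next
      case False
      then have xpos: "?x > 0" by simp
      have "(?x powr q) ^ k = ?x powr (real k * q)"
        using False by (rule powr_power)
      also have "real k * q = real m"
        using km by (simp add: q_def)
      also have "?x powr real m = ?x ^ m"
        using xpos by (rule powr_realpow)
      finally have "(?x powr q) ^ k = ?u ^ k"
        unfolding eq .
      then show ?thesis
        by (rule power_eq_imp_eq_base) (use km in simp_all)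
    qed
    finally have "rpow ?x t \<le> C * s" using elim by linarith
    then show ?case using elim by (simp add: field_simps)
  qed
  then have "Limsup (at_right 0) (\<lambda>s. ereal (inverse s * rpow (cmod (fourier \<mu> (\<alpha> s))) t)) \<le> ereal C"
    by (rule Limsup_bounded)
  with lim show False by simp
qed

end

text \<open>On a conditionally complete order, bounding a supremum from above needs a nonempty index set.
  The exponent \<open>0\<close> and the constant paths show this for the suprema in \<open>t0\<close>.\<close>

lemma zero_exponent_admissible:
  "Limsup (at_right 0) (\<lambda>s. ereal (inverse s * rpow (F s) 0)) = \<infinity>"
proof -
  have "((\<lambda>s. ereal (inverse s)) \<longlongrightarrow> \<infinity>) (at_right (0::real))"
    unfolding tendsto_PInfty_eq_at_top by (rule filterlim_inverse_at_top_right)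
  then have "Limsup (at_right 0) (\<lambda>s::real. ereal (inverse s)) = \<infinity>"
    by (intro lim_imp_Limsup trivial_limit_at_right_real)
  then show ?thesis
    unfolding rpow_def by (simp only: mult_1_right simp_thms if_True)
qed

lemma smooth_curve_const: "smooth_curve (\<lambda>_. c)"
  unfolding smooth_curve_def
  by (intro exI[of _ "\<lambda>k. if k = 0 then (\<lambda>_. c) else (\<lambda>_. 0)"]) simp

lemma constant_path_smooth:
  assumes "x \<in> carrier (RT_group d n)"
  shows "(\<lambda>_. \<Phi> x) \<in> smooth_paths d n \<Phi> (\<Phi> x)"
proof -
  have "smooth_RT_path d n (\<lambda>_. x)"
    using assms by (simp add: smooth_RT_path_def smooth_curve_const)
  then show ?thesis
    unfolding smooth_paths_def
    by (intro CollectI conjI refl exI[of _ "\<lambda>_. x"] ballI)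
qed

theorem theorem3p2:
  fixes \<mu> :: "'g::{topological_ab_group_add, t2_space} measure"
    and d n :: nat
    and \<Phi> :: "(nat \<Rightarrow> real) \<times> (nat \<Rightarrow> complex) \<Rightarrow> 'g \<Rightarrow> complex"
  assumes "locally_compact_space (euclidean :: 'g topology)"
    and "\<Phi> \<in> iso (RT_group d n) dual_group"
    and "homeomorphic_map (RT_topology d n) dual_topology \<Phi>"
    and "prob_space \<mu>"
    and "sets \<mu> = sets borel"
    and "zero_set \<mu> \<noteq> {}"
    and "C3_at_one d n \<Phi> (fourier \<mu>)"
  shows "Lambda_alg \<mu> \<subseteq> \<rat> \<inter> {t0 d n \<Phi> \<mu>..}"
proof
  fix q assume "q \<in> Lambda_alg \<mu>"
  then obtain m k \<nu> where q: "q = real m / real k" and km: "k \<ge> 1" "m \<ge> 1"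
    and \<nu>: "prob_space \<nu>" "sets \<nu> = sets borel"
    and root: "\<forall>\<gamma>\<in>characters. fourier \<mu> \<gamma> ^ m = fourier \<nu> \<gamma> ^ k"
    unfolding Lambda_alg_def characteristic_function_def by force
  have \<nu>': "borel_prob_space \<nu>"
    using \<nu> by (simp add: borel_prob_space_def borel_prob_space_axioms_def)
  interpret RT_dual_measure \<mu> d n \<Phi>
    using assms by (simp add: RT_dual_measure_def borel_prob_space_def
        borel_prob_space_axioms_def RT_dual_measure_axioms_def iso_def)
  have surj: "\<Phi> ` carrier (RT_group d n) = characters"
    using assms(2) by (auto simp: iso_def dual_group_def bij_betw_def)
  have "t0 d n \<Phi> \<mu> \<le> q"
    unfolding t0_def
  proof (intro cSUP_least cSup_least)
    fix \<gamma>\<^sub>0 assume "\<gamma>\<^sub>0 \<in> zero_set \<mu>"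
    then have "\<gamma>\<^sub>0 \<in> \<Phi> ` carrier (RT_group d n)"
      unfolding surj zero_set_def by simp
    then obtain x where "x \<in> carrier (RT_group d n)" "\<gamma>\<^sub>0 = \<Phi> x" by blast
    then show "smooth_paths d n \<Phi> \<gamma>\<^sub>0 \<noteq> {}"
      using constant_path_smooth[of x d n \<Phi>] by auto
  next
    fix \<gamma>\<^sub>0 \<alpha>
    have "0 \<in> {t. 0 \<le> t \<and> Limsup (at_right 0)
        (\<lambda>s. ereal (inverse s * rpow (cmod (fourier \<mu> (\<alpha> s))) t)) = \<infinity>}"
      by (intro CollectI conjI order_refl zero_exponent_admissible)
    then show "{t. 0 \<le> t \<and> Limsup (at_right 0)
        (\<lambda>s. ereal (inverse s * rpow (cmod (fourier \<mu> (\<alpha> s))) t)) = \<infinity>} \<noteq> {}"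
      by (metis empty_iff)
  next
    fix \<gamma>\<^sub>0 \<alpha> t
    assume "\<gamma>\<^sub>0 \<in> zero_set \<mu>" "\<alpha> \<in> smooth_paths d n \<Phi> \<gamma>\<^sub>0"
      and t: "t \<in> {t. 0 \<le> t \<and> Limsup (at_right 0)
        (\<lambda>s. ereal (inverse s * rpow (cmod (fourier \<mu> (\<alpha> s))) t)) = \<infinity>}"
    then show "t \<le> q"
      unfolding q mem_Collect_eq by (intro admissible_exponent_le[OF assms(7) \<nu>' km root]) (assumption | erule conjunct2)+
  qed (fact assms(6))
  then show "q \<in> \<rat> \<inter> {t0 d n \<Phi> \<mu>..}" by (simp add: q)
qed

end
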